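(* There exist a commutative ring $R$, an ideal $\mathfrak{a}\subseteq R$, and an $R$-module $M$ such that $M$ is $\mathfrak{a}$-fair, but not weakly $\mathfrak{a}$-quasifair.
   Context: Rings are commutative with unit. $\mathrm{Var}(\mathfrak{a})$ is the set of prime ideals of $R$ containing $\mathfrak{a}$, and $\Gamma_{\mathfrak{a}}(M)=\{x\in M\mid\exists n\in\mathbb{N}:\mathfrak{a}^nx=0\}$. For $x\in M$, $(0:_Rx)=\{r\in R\mid rx=0\}$. The assassin $\mathrm{Ass}_R(M)$ is the set of prime ideals of $R$ of the form $(0:_Rx)$ for some $x\in M$. The weak assassin $\mathrm{Ass}^{\rm f}_R(M)$ is the set of prime ideals $\mathfrak{p}$ of $R$ such that there exists $x\in M$ for which $\mathfrak{p}$ is minimal (with respect to inclusion) among the prime ideals containing $(0:_Rx)$. The $R$-module $M$ is called $\mathfrak{a}$-fair if $\mathrm{Ass}_R(M/\Gamma_{\mathfrak{a}}(M))=\mathrm{Ass}_R(M)\setminus\mathrm{Var}(\mathfrak{a})$, and weakly $\mathfrak{a}$-quasifair if $\mathrm{Ass}^{\rm f}_R(\Gamma_{\mathfrak{a}}(M))=\mathrm{Ass}^{\rm f}_R(M)\cap\mathrm{Var}(\mathfrak{a})$. *)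

theory Defs
  imports "HOL-Algebra.Module" "HOL-Algebra.Ideal_Product"
begin

definition Var :: "('a, 'r) ring_scheme \<Rightarrow> 'a set \<Rightarrow> 'a set set" where
  "Var R \<aa> = {\<pp>. primeideal \<pp> R \<and> \<aa> \<subseteq> \<pp>}"

definition annihilator :: "('a, 'r) ring_scheme \<Rightarrow> ('a, 'm, 'x) module_scheme \<Rightarrow> 'm \<Rightarrow> 'a set" where
  "annihilator R M x = {r \<in> carrier R. r \<odot>\<^bsub>M\<^esub> x = \<zero>\<^bsub>M\<^esub>}"

definition torsion :: "('a, 'r) ring_scheme \<Rightarrow> 'a set \<Rightarrow> ('a, 'm, 'x) module_scheme \<Rightarrow> 'm set" where
  "torsion R \<aa> M =
     {x \<in> carrier M. \<exists>n::nat. \<forall>r \<in> \<aa> [^]\<^bsub>ideals_set R\<^esub> n. r \<odot>\<^bsub>M\<^esub> x = \<zero>\<^bsub>M\<^esub>}"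

abbreviation torsion_module ::
    "('a, 'r) ring_scheme \<Rightarrow> 'a set \<Rightarrow> ('a, 'm, 'x) module_scheme \<Rightarrow> ('a, 'm, 'x) module_scheme" where
  "torsion_module R \<aa> M \<equiv> M\<lparr>carrier := torsion R \<aa> M\<rparr>"

text \<open>The record type of modules extends that of rings, but the locale of modules says nothing
  about the fields for the multiplication and the unit; in a quotient module they are left
  unspecified. A scalar acts on a coset by multiplying a representative, and the union over all
  representatives avoids a choice.\<close>

definition quotient_module :: "('a, 'm, 'x) module_scheme \<Rightarrow> 'm set \<Rightarrow> ('a, 'm set) module" where
  "quotient_module M N =
     \<lparr>carrier = a_rcosets\<^bsub>M\<^esub> N, mult = undefined, one = undefined,
      zero = N, add = set_add M,
      smult = (\<lambda>r C. \<Union>x\<in>C. N +>\<^bsub>M\<^esub> (r \<odot>\<^bsub>M\<^esub> x))\<rparr>"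

definition assassin :: "('a, 'r) ring_scheme \<Rightarrow> ('a, 'm, 'x) module_scheme \<Rightarrow> 'a set set" where
  "assassin R M = {\<pp>. primeideal \<pp> R \<and> (\<exists>x \<in> carrier M. \<pp> = annihilator R M x)}"

definition weak_assassin :: "('a, 'r) ring_scheme \<Rightarrow> ('a, 'm, 'x) module_scheme \<Rightarrow> 'a set set" where
  "weak_assassin R M =
     {\<pp>. primeideal \<pp> R \<and>
          (\<exists>x \<in> carrier M. \<pp> \<in> Var R (annihilator R M x) \<and>
             (\<forall>\<qq> \<in> Var R (annihilator R M x). \<qq> \<subseteq> \<pp> \<longrightarrow> \<qq> = \<pp>))}"

definition fair :: "('a, 'r) ring_scheme \<Rightarrow> 'a set \<Rightarrow> ('a, 'm, 'x) module_scheme \<Rightarrow> bool" where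
  "fair R \<aa> M \<longleftrightarrow>
     assassin R (quotient_module M (torsion R \<aa> M)) = assassin R M - Var R \<aa>"

definition weakly_quasifair :: "('a, 'r) ring_scheme \<Rightarrow> 'a set \<Rightarrow> ('a, 'm, 'x) module_scheme \<Rightarrow> bool" where
  "weakly_quasifair R \<aa> M \<longleftrightarrow>
     weak_assassin R (torsion_module R \<aa> M) = weak_assassin R M \<inter> Var R \<aa>"

lemma (in cring) ideal_power_is_ideal:
  assumes "ideal \<aa> R"
  shows "ideal (\<aa> [^]\<^bsub>ideals_set R\<^esub> (n::nat)) R"
proof -
  interpret I: comm_monoid "ideals_set R" by (rule ideals_set_is_comm_monoid)
  show ?thesis using I.nat_pow_closed[of \<aa> n] assms by (simp add: ideals_set_def)
qed

lemma (in cring) ideal_power_add_subset: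
  assumes "ideal \<aa> R"
  shows "\<aa> [^]\<^bsub>ideals_set R\<^esub> (m + n::nat)
         \<subseteq> \<aa> [^]\<^bsub>ideals_set R\<^esub> m \<inter> \<aa> [^]\<^bsub>ideals_set R\<^esub> n"
proof -
  interpret I: comm_monoid "ideals_set R" by (rule ideals_set_is_comm_monoid)
  have "\<aa> \<in> carrier (ideals_set R)" using assms by (simp add: ideals_set_def)
  then have "\<aa> [^]\<^bsub>ideals_set R\<^esub> (m + n)
      = ideal_prod R (\<aa> [^]\<^bsub>ideals_set R\<^esub> m) (\<aa> [^]\<^bsub>ideals_set R\<^esub> n)"
    using I.nat_pow_mult[of \<aa> m n] by (simp add: ideals_set_def)
  then show ?thesis
    using ideal_prod_inter[OF ideal_power_is_ideal ideal_power_is_ideal] assms by metis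
qed

lemma (in module) torsion_submodule:
  assumes "ideal \<aa> R"
  shows "submodule (torsion R \<aa> M) R M"
proof (rule submoduleI)
  note pow = R.ideal_power_is_ideal[OF assms]
  have carr: "r \<in> carrier R" if "r \<in> \<aa> [^]\<^bsub>ideals_set R\<^esub> (n::nat)" for r n
    using that ideal.Icarr[OF pow] by blast
  show "torsion R \<aa> M \<subseteq> carrier M" by (auto simp: torsion_def)
  show "\<zero>\<^bsub>M\<^esub> \<in> torsion R \<aa> M" by (auto simp: torsion_def carr)
  show "\<ominus>\<^bsub>M\<^esub> x \<in> torsion R \<aa> M" if "x \<in> torsion R \<aa> M" for x
    using that by (fastforce simp: torsion_def smult_r_minus carr)
  show "x \<oplus>\<^bsub>M\<^esub> y \<in> torsion R \<aa> M" if x: "x \<in> torsion R \<aa> M" and y: "y \<in> torsion R \<aa> M" for x y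
  proof -
    from x y have c: "x \<in> carrier M" "y \<in> carrier M" by (auto simp: torsion_def)
    from x obtain m :: nat where m: "\<forall>r \<in> \<aa> [^]\<^bsub>ideals_set R\<^esub> m. r \<odot>\<^bsub>M\<^esub> x = \<zero>\<^bsub>M\<^esub>"
      by (auto simp: torsion_def)
    from y obtain n :: nat where n: "\<forall>r \<in> \<aa> [^]\<^bsub>ideals_set R\<^esub> n. r \<odot>\<^bsub>M\<^esub> y = \<zero>\<^bsub>M\<^esub>"
      by (auto simp: torsion_def)
    have "r \<odot>\<^bsub>M\<^esub> (x \<oplus>\<^bsub>M\<^esub> y) = \<zero>\<^bsub>M\<^esub>" if "r \<in> \<aa> [^]\<^bsub>ideals_set R\<^esub> (m + n)" for r
    proof -
      have "r \<odot>\<^bsub>M\<^esub> x = \<zero>\<^bsub>M\<^esub>" "r \<odot>\<^bsub>M\<^esub> y = \<zero>\<^bsub>M\<^esub>"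
        using that m n R.ideal_power_add_subset[OF assms, of m n] by blast+
      then show ?thesis using c carr[OF that] by (simp add: smult_r_distr)
    qed
    then show ?thesis using c unfolding torsion_def by blast
  qed
  show "s \<odot>\<^bsub>M\<^esub> x \<in> torsion R \<aa> M" if s: "s \<in> carrier R" and x: "x \<in> torsion R \<aa> M" for s x
  proof -
    from x have c: "x \<in> carrier M" by (auto simp: torsion_def)
    from x obtain n :: nat where n: "\<forall>r \<in> \<aa> [^]\<^bsub>ideals_set R\<^esub> n. r \<odot>\<^bsub>M\<^esub> x = \<zero>\<^bsub>M\<^esub>"
      by (auto simp: torsion_def)
    have "r \<odot>\<^bsub>M\<^esub> (s \<odot>\<^bsub>M\<^esub> x) = \<zero>\<^bsub>M\<^esub>" if "r \<in> \<aa> [^]\<^bsub>ideals_set R\<^esub> n" for r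
    proof -
      have "r \<odot>\<^bsub>M\<^esub> (s \<odot>\<^bsub>M\<^esub> x) = s \<odot>\<^bsub>M\<^esub> (r \<odot>\<^bsub>M\<^esub> x)"
        using smult_assoc1[OF s carr[OF that] c] smult_assoc1[OF carr[OF that] s c]
          R.m_comm[OF s carr[OF that]] by simp
      then show ?thesis using n that s by simp
    qed
    then show ?thesis using s c unfolding torsion_def by blast
  qed
qed

lemma (in module) quotient_module_smult:
  assumes N: "submodule N R M" and r: "r \<in> carrier R" and x: "x \<in> carrier M"
  shows "r \<odot>\<^bsub>quotient_module M N\<^esub> (N +>\<^bsub>M\<^esub> x) = N +>\<^bsub>M\<^esub> (r \<odot>\<^bsub>M\<^esub> x)"
proof -
  have sg: "subgroup N (add_monoid M)" by (rule submodule.axioms(1)[OF N])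
  have eq: "N +>\<^bsub>M\<^esub> (r \<odot>\<^bsub>M\<^esub> y) = N +>\<^bsub>M\<^esub> (r \<odot>\<^bsub>M\<^esub> x)" if "y \<in> N +>\<^bsub>M\<^esub> x" for y
  proof -
    from that obtain h where h: "h \<in> N" "y = h \<oplus>\<^bsub>M\<^esub> x" by (auto simp: a_r_coset_def')
    have hc: "h \<in> carrier M" using h submoduleE(1)[OF N] by blast
    have "r \<odot>\<^bsub>M\<^esub> y = (r \<odot>\<^bsub>M\<^esub> h) \<oplus>\<^bsub>M\<^esub> (r \<odot>\<^bsub>M\<^esub> x)"
      using h hc r x by (simp add: smult_r_distr)
    then have "r \<odot>\<^bsub>M\<^esub> y \<in> N +>\<^bsub>M\<^esub> (r \<odot>\<^bsub>M\<^esub> x)"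
      using submodule.smult_closed[OF N r h(1)] by (auto simp: a_r_coset_def')
    then show ?thesis
      using M.a_repr_independence[OF _ _ sg] smult_closed[OF r x] by metis
  qed
  have "x \<in> N +>\<^bsub>M\<^esub> x" using x subgroup.one_closed[OF sg] M.l_zero[OF x] by (force simp: a_r_coset_def')
  then have "(\<Union>y\<in>N +>\<^bsub>M\<^esub> x. N +>\<^bsub>M\<^esub> (r \<odot>\<^bsub>M\<^esub> y)) = N +>\<^bsub>M\<^esub> (r \<odot>\<^bsub>M\<^esub> x)"
    using eq by blast
  then show ?thesis by (simp add: quotient_module_def)
qed

lemma (in module) quotient_module_is_module:
  assumes N: "submodule N R M"
  shows "module R (quotient_module M N)"
proof -
  let ?Q = "quotient_module M N"
  have sg: "subgroup N (add_monoid M)" by (rule submodule.axioms(1)[OF N])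
  have as: "abelian_subgroup N M"
    using abelian_subgroupI3[of N M] sg M.abelian_group_axioms
    by (simp add: additive_subgroup_def)
  have carrE: thesis
    if "C \<in> carrier ?Q" "\<And>x. x \<in> carrier M \<Longrightarrow> C = N +>\<^bsub>M\<^esub> x \<Longrightarrow> thesis" for C thesis
    using that by (auto simp: quotient_module_def A_RCOSETS_def')
  have carrI: "N +>\<^bsub>M\<^esub> x \<in> carrier ?Q" if "x \<in> carrier M" for x
    using that by (auto simp: quotient_module_def A_RCOSETS_def')
  have add: "(N +>\<^bsub>M\<^esub> x) \<oplus>\<^bsub>?Q\<^esub> (N +>\<^bsub>M\<^esub> y) = N +>\<^bsub>M\<^esub> (x \<oplus>\<^bsub>M\<^esub> y)"
    if "x \<in> carrier M" "y \<in> carrier M" for x y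
    using abelian_subgroup.a_rcos_sum[OF as that] by (simp add: quotient_module_def)
  note sm = quotient_module_smult[OF N]
  have zero: "\<zero>\<^bsub>?Q\<^esub> = N +>\<^bsub>M\<^esub> \<zero>\<^bsub>M\<^esub>"
    using M.a_coset_join2[of "\<zero>\<^bsub>M\<^esub>" N] sg subgroup.one_closed[OF sg]
    by (simp add: quotient_module_def)
  show ?thesis
  proof (rule moduleI)
    show "cring R" by (rule R.is_cring)
    show "abelian_group ?Q"
    proof (rule abelian_groupI)
      fix C assume "C \<in> carrier ?Q"
      then obtain x where x: "x \<in> carrier M" "C = N +>\<^bsub>M\<^esub> x" using carrE by blast
      show "\<zero>\<^bsub>?Q\<^esub> \<oplus>\<^bsub>?Q\<^esub> C = C" using x by (simp add: zero add)
      show "\<exists>Y \<in> carrier ?Q. Y \<oplus>\<^bsub>?Q\<^esub> C = \<zero>\<^bsub>?Q\<^esub>"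
        using x carrI[of "\<ominus>\<^bsub>M\<^esub> x"] by (intro bexI[of _ "N +>\<^bsub>M\<^esub> (\<ominus>\<^bsub>M\<^esub> x)"]) (simp_all add: zero add M.l_neg)
    qed (auto elim!: carrE simp: add zero M.a_ac intro!: carrI)
  qed (auto elim!: carrE simp: add sm smult_l_distr smult_r_distr smult_assoc1 intro!: carrI)
qed

end

theory Submission
  imports Defs
begin

text \<open>
  The ring is the Boolean algebra of the finite and cofinite sets of natural numbers, with symmetric
  difference as addition and intersection as multiplication. The ideal is the ideal \<open>\<aa>\<close> of the
  finite sets, and the module is the ring itself.

  A set that is annihilated by some power of \<open>\<aa>\<close> is disjoint from all singletons, as these are
  idempotent elements of \<open>\<aa>\<close>; hence it is empty, and the torsion submodule is zero. For a module
  without torsion, being fair means that no prime of the assassin contains \<open>\<aa>\<close>, and being weakly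
  quasifair means the same for the weak assassin. The two conditions differ here. A prime
  annihilator of a single element that contains \<open>\<aa>\<close> would be the annihilator of a torsion element,
  hence of zero, and so would be the whole ring. But \<open>\<aa>\<close> itself is a minimal prime: if a prime
  \<open>\<qq> \<subseteq> \<aa>\<close> omitted a finite set, it would contain the complement, which is not finite. So \<open>\<aa>\<close> is
  minimal over the annihilator of the unit, which is zero, and belongs to the weak assassin.
\<close>

section \<open>Modules without torsion\<close>

lemma (in module) assassin_quotient_zero:
  "assassin R (quotient_module M {\<zero>\<^bsub>M\<^esub>}) = assassin R M"
proof -
  let ?Q = "quotient_module M {\<zero>\<^bsub>M\<^esub>}"
  have coset: "{\<zero>\<^bsub>M\<^esub>} +>\<^bsub>M\<^esub> x = {x}" if "x \<in> carrier M" for x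
    using that by (simp add: a_r_coset_def')
  have carr: "carrier ?Q = (\<lambda>x. {x}) ` carrier M"
    using coset by (auto simp: quotient_module_def A_RCOSETS_def')
  have "annihilator R ?Q {x} = annihilator R M x" if "x \<in> carrier M" for x
    using that coset by (auto simp: annihilator_def quotient_module_def)
  then show ?thesis by (auto simp: assassin_def carr)
qed

text \<open>A prime in the assassin that contains \<open>\<aa>\<close> is the annihilator of an element killed by the
  first power of \<open>\<aa>\<close>; such an element is zero, and the annihilator of zero is not a proper ideal.\<close>

lemma (in module) fair_if_torsion_zero:
  assumes \<aa>: "ideal \<aa> R" and tors: "torsion R \<aa> M = {\<zero>\<^bsub>M\<^esub>}"
  shows "fair R \<aa> M"
proof -
  interpret I: comm_monoid "ideals_set R" by (rule R.ideals_set_is_comm_monoid)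
  have pow1: "\<aa> [^]\<^bsub>ideals_set R\<^esub> (1::nat) = \<aa>"
  proof -
    have "\<aa> \<in> carrier (ideals_set R)" using \<aa> by (simp add: ideals_set_def)
    then show ?thesis by simp
  qed
  have "\<pp> \<notin> Var R \<aa>" if "\<pp> \<in> assassin R M" for \<pp>
  proof
    assume "\<pp> \<in> Var R \<aa>"
    then have sub: "\<aa> \<subseteq> \<pp>" by (simp add: Var_def)
    from that obtain x where pr: "primeideal \<pp> R" and x: "x \<in> carrier M" "\<pp> = annihilator R M x"
      unfolding assassin_def by blast
    have "\<forall>r \<in> \<aa> [^]\<^bsub>ideals_set R\<^esub> (1::nat). r \<odot>\<^bsub>M\<^esub> x = \<zero>\<^bsub>M\<^esub>"
      using x sub unfolding pow1 annihilator_def by blast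
    then have "x \<in> torsion R \<aa> M"
      using x(1) unfolding torsion_def by blast
    then have "x = \<zero>\<^bsub>M\<^esub>" using tors by blast
    moreover have "annihilator R M \<zero>\<^bsub>M\<^esub> = carrier R" by (auto simp: annihilator_def)
    ultimately have "carrier R = \<pp>" using x(2) by metis
    then show False using primeideal.I_notcarr[OF pr] by simp
  qed
  then show ?thesis by (auto simp: fair_def tors assassin_quotient_zero)
qed

lemma (in module) weak_assassin_zero:
  "weak_assassin R (M\<lparr>carrier := {\<zero>\<^bsub>M\<^esub>}\<rparr>) = {}"
proof -
  have "annihilator R (M\<lparr>carrier := {\<zero>\<^bsub>M\<^esub>}\<rparr>) \<zero>\<^bsub>M\<^esub> = carrier R"
    by (auto simp: annihilator_def)
  moreover have "\<pp> \<notin> Var R (carrier R)" for \<pp>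
    using ideal.Icarr[OF primeideal.axioms(1)] primeideal.I_notcarr by (fastforce simp: Var_def)
  ultimately show ?thesis by (auto simp: weak_assassin_def)
qed

lemma (in cring) idempotent_in_ideal_power:
  assumes "ideal \<aa> R" and e: "e \<in> \<aa>" "e \<otimes> e = e"
  shows "e \<in> \<aa> [^]\<^bsub>ideals_set R\<^esub> (n::nat)"
proof (induction n)
  case 0
  show ?case using ideal.Icarr[OF assms(1) e(1)] by (simp add: ideals_set_def)
next
  case (Suc n)
  have "e \<otimes> e \<in> ideal_prod R (\<aa> [^]\<^bsub>ideals_set R\<^esub> n) \<aa>"
    using Suc e(1) by (rule ideal_prod.prod)
  then show ?case using e(2) by (simp add: ideals_set_def)
qed

section \<open>The Boolean ring of finite and cofinite sets\<close>

definition fincof :: "nat set set" where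
  "fincof = {A. finite A \<or> finite (- A)}"

definition fincof_ring :: "nat set ring" where
  "fincof_ring = \<lparr>carrier = fincof, mult = (\<inter>), one = UNIV, zero = {}, add = (\<lambda>A B. sym_diff A B)\<rparr>"

definition fincof_module :: "(nat set, nat set) module" where
  "fincof_module = \<lparr>carrier = fincof, mult = (\<inter>), one = UNIV, zero = {},
     add = (\<lambda>A B. sym_diff A B), smult = (\<inter>)\<rparr>"

definition finite_sets :: "nat set set" where
  "finite_sets = {A. finite A}"

lemma fincof_Int: "A \<in> fincof \<Longrightarrow> B \<in> fincof \<Longrightarrow> A \<inter> B \<in> fincof"
  by (auto simp: fincof_def)

lemma fincof_Compl: "A \<in> fincof \<Longrightarrow> - A \<in> fincof"
  by (auto simp: fincof_def)

lemma fincof_sym_diff: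
  assumes "A \<in> fincof" "B \<in> fincof"
  shows "sym_diff A B \<in> fincof"
proof -
  have "- (- (A \<inter> - B) \<inter> - (B \<inter> - A)) \<in> fincof"
    using assms by (intro fincof_Int fincof_Compl)
  also have "- (- (A \<inter> - B) \<inter> - (B \<inter> - A)) = sym_diff A B" by blast
  finally show ?thesis .
qed

lemma cring_fincof: "cring fincof_ring"
proof (rule cringI)
  show "abelian_group fincof_ring"
  proof (rule abelian_groupI)
    show "\<exists>B\<in>carrier fincof_ring. B \<oplus>\<^bsub>fincof_ring\<^esub> A = \<zero>\<^bsub>fincof_ring\<^esub>"
      if "A \<in> carrier fincof_ring" for A
      using that by (intro bexI[of _ A]) (auto simp: fincof_ring_def)
    show "\<zero>\<^bsub>fincof_ring\<^esub> \<in> carrier fincof_ring" by (simp add: fincof_ring_def fincof_def)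
  qed (auto simp: fincof_ring_def intro: fincof_sym_diff)
  show "Group.comm_monoid fincof_ring"
    by (rule comm_monoidI) (auto simp: fincof_ring_def intro: fincof_Int, simp add: fincof_def)
qed (auto simp: fincof_ring_def)

lemma module_fincof: "module fincof_ring fincof_module"
proof (rule moduleI)
  show "cring fincof_ring" by (rule cring_fincof)
  show "abelian_group fincof_module"
  proof (rule abelian_groupI)
    show "\<exists>B\<in>carrier fincof_module. B \<oplus>\<^bsub>fincof_module\<^esub> A = \<zero>\<^bsub>fincof_module\<^esub>"
      if "A \<in> carrier fincof_module" for A
      using that by (intro bexI[of _ A]) (auto simp: fincof_module_def)
    show "\<zero>\<^bsub>fincof_module\<^esub> \<in> carrier fincof_module" by (simp add: fincof_module_def fincof_def)
  qed (auto simp: fincof_module_def intro: fincof_sym_diff)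
qed (auto simp: fincof_ring_def fincof_module_def intro: fincof_Int)

lemma primeideal_finite_sets: "primeideal finite_sets fincof_ring"
proof (rule primeidealI)
  interpret R: cring fincof_ring by (rule cring_fincof)
  show "ideal finite_sets fincof_ring"
  proof (rule idealI)
    show "ring fincof_ring" by (rule R.ring_axioms)
    show "subgroup finite_sets (add_monoid fincof_ring)"
    proof (rule R.add.subgroupI)
      show "\<ominus>\<^bsub>fincof_ring\<^esub> A \<in> finite_sets" if "A \<in> finite_sets" for A
      proof -
        have "\<ominus>\<^bsub>fincof_ring\<^esub> A = A"
          \<comment> \<open>the additive group of a Boolean ring has exponent two\<close>
          using that by (intro R.minus_equality) (auto simp: fincof_ring_def fincof_def finite_sets_def)
        then show ?thesis using that by simp
      qed
    qed (auto simp: fincof_ring_def finite_sets_def fincof_def)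
  qed (auto simp: fincof_ring_def finite_sets_def)
  show "carrier fincof_ring \<noteq> finite_sets"
  proof -
    have "UNIV \<in> fincof" "UNIV \<notin> finite_sets" by (auto simp: fincof_def finite_sets_def)
    then show ?thesis by (auto simp: fincof_ring_def)
  qed
  show "A \<in> finite_sets \<or> B \<in> finite_sets"
    if "A \<in> carrier fincof_ring" "B \<in> carrier fincof_ring" "A \<otimes>\<^bsub>fincof_ring\<^esub> B \<in> finite_sets" for A B
  proof (rule ccontr)
    assume "\<not> ?thesis"
    then have "finite (- A)" "finite (- B)" "finite (A \<inter> B)"
      using that by (auto simp: fincof_ring_def finite_sets_def fincof_def)
    then have "finite ((- A) \<union> (- B) \<union> (A \<inter> B))" by blast
    moreover have "(- A) \<union> (- B) \<union> (A \<inter> B) = UNIV" by blast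
    ultimately show False by simp
  qed
qed (rule cring_fincof)

lemma torsion_fincof: "torsion fincof_ring finite_sets fincof_module = {{}}"
proof -
  interpret R: cring fincof_ring by (rule cring_fincof)
  note ideal = primeideal.axioms(1)[OF primeideal_finite_sets]
  have "x = {}" if "x \<in> torsion fincof_ring finite_sets fincof_module" for x
  proof -
    from that obtain n :: nat where
      n: "\<forall>r \<in> finite_sets [^]\<^bsub>ideals_set fincof_ring\<^esub> n. r \<inter> x = {}"
      by (auto simp: torsion_def fincof_module_def)
    have "{k} \<inter> x = {}" for k
      by (rule bspec[OF n], rule R.idempotent_in_ideal_power[OF ideal])
        (auto simp: finite_sets_def fincof_ring_def)
    then show ?thesis by blast
  qed
  moreover have "{} \<in> torsion fincof_ring finite_sets fincof_module"
    by (simp add: torsion_def fincof_module_def fincof_def)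
  ultimately show ?thesis by blast
qed

text \<open>In a Boolean ring every prime contains an element or its complement, so comparable primes are
  equal.\<close>

lemma prime_subset_finite_sets:
  assumes "primeideal \<qq> fincof_ring" "\<qq> \<subseteq> finite_sets"
  shows "\<qq> = finite_sets"
proof -
  interpret Q: primeideal \<qq> fincof_ring by (rule assms(1))
  have "A \<in> \<qq>" if "finite A" for A
  proof -
    have "{} \<in> \<qq>" using additive_subgroup.zero_closed[OF Q.additive_subgroup_axioms] by (simp add: fincof_ring_def)
    then have "A \<in> \<qq> \<or> - A \<in> \<qq>"
      using that Q.I_prime[of A "- A"] by (simp add: fincof_ring_def fincof_def)
    moreover have "- A \<notin> \<qq>" using assms(2) that by (auto simp: finite_sets_def)
    ultimately show ?thesis by blast
  qed
  then show ?thesis using assms(2) by (auto simp: finite_sets_def)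
qed

lemma finite_sets_in_weak_assassin: "finite_sets \<in> weak_assassin fincof_ring fincof_module"
proof -
  have "annihilator fincof_ring fincof_module UNIV = {{}}"
    by (auto simp: annihilator_def fincof_ring_def fincof_module_def fincof_def)
  moreover have "{} \<in> finite_sets" by (simp add: finite_sets_def)
  ultimately have "finite_sets \<in> Var fincof_ring (annihilator fincof_ring fincof_module UNIV)"
    using primeideal_finite_sets by (simp add: Var_def)
  moreover have "UNIV \<in> carrier fincof_module" by (simp add: fincof_module_def fincof_def)
  moreover have "\<qq> = finite_sets"
    if "\<qq> \<in> Var fincof_ring I" "\<qq> \<subseteq> finite_sets" for \<qq> I
    using that by (intro prime_subset_finite_sets) (auto simp: Var_def)
  ultimately show ?thesis
    using primeideal_finite_sets unfolding weak_assassin_def by blast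
qed

section \<open>A fair module that is not weakly quasifair\<close>

theorem mainTheorem5:
  shows "\<exists>(R :: nat set ring) (\<aa> :: nat set set) (M :: (nat set, nat set) module).
           cring R \<and> ideal \<aa> R \<and> module R M \<and> fair R \<aa> M \<and> \<not> weakly_quasifair R \<aa> M"
proof (intro exI conjI)
  interpret M: module fincof_ring fincof_module by (rule module_fincof)
  have zero: "\<zero>\<^bsub>fincof_module\<^esub> = {}" by (simp add: fincof_module_def)
  show "cring fincof_ring" by (rule cring_fincof)
  show ideal: "ideal finite_sets fincof_ring" by (rule primeideal.axioms(1)[OF primeideal_finite_sets])
  show "module fincof_ring fincof_module" by (rule module_fincof)
  show "fair fincof_ring finite_sets fincof_module"
    using ideal by (rule M.fair_if_torsion_zero) (simp add: torsion_fincof zero)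
  have "finite_sets \<in> weak_assassin fincof_ring fincof_module \<inter> Var fincof_ring finite_sets"
    using finite_sets_in_weak_assassin primeideal_finite_sets by (simp add: Var_def)
  then show "\<not> weakly_quasifair fincof_ring finite_sets fincof_module"
    using M.weak_assassin_zero unfolding weakly_quasifair_def torsion_fincof zero by blast
qed

end
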